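(* Let $\mathbf{UAlg}$ be a category of universal algebras with representable forgetful functor to $\mathbf{Set}$. Then every topological algebra $\mathfrak{A}$ (of $\mathbf{UAlg}$) is a schizophrenic object, and so yields a natural dual adjunction between $\mathbf{UAlg}$ and $\mathbf{Top}$.
   Context: $|\cdot|$ denotes underlying sets and maps. A topological algebra $\mathfrak{A}$ is an algebra in $\mathbf{UAlg}$ with a topology for which all algebra operations are continuous; it is viewed both as an object of $\mathbf{UAlg}$ and as an object of $\mathbf{Top}$. For an algebra $B$ and $b\in|B|$, the evaluation map is $ev_{B,b}:\mathbf{UAlg}(B,\mathfrak{A})\to|\mathfrak{A}|$, $h\mapsto h(b)$; for a space $X$ and $x\in|X|$, it is $ev_{X,x}:\mathbf{Top}(X,\mathfrak{A})\to|\mathfrak{A}|$, $u\mapsto u(x)$. $\mathfrak{A}$ is a schizophrenic object when: (i) each set $\mathbf{UAlg}(B,\mathfrak{A})$ carries a topology for which all $ev_{B,b}$ are continuous and which is initial with respect to them: a map $g:|X|\to\mathbf{UAlg}(B,\mathfrak{A})$ from a space $X$ is continuous iff all $ev_{B,b}\circ g$ are; (ii) each set $\mathbf{Top}(X,\mathfrak{A})$ carries an algebra structure (with pointwise operations) for which all $ev_{X,x}$ are homomorphisms and which is initial with respect to them: a map $g:|B|\to\mathbf{Top}(X,\mathfrak{A})$ from an algebra $B$ is a homomorphism iff all $ev_{X,x}\circ g$ are. A natural dual adjunction given by $\mathfrak{A}$ is a pair of functors $S:\mathbf{UAlg}^{op}\to\mathbf{Top}$, $T:\mathbf{Top}^{op}\to\mathbf{UAlg}$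 with $|S(B)|=\mathbf{UAlg}(B,\mathfrak{A})$, $|T(X)|=\mathbf{Top}(X,\mathfrak{A})$ (acting on morphisms by precomposition), carrying the initial structures above, together with bijections $\mathbf{UAlg}(B,T(X))\cong\mathbf{Top}(X,S(B))$ natural in $B$ and $X$. *)

theory Defs
  imports "HOL-Analysis.Analysis"
begin

section \<open>Universal algebras\<close>

text \<open>
  A category of universal algebras is given by a presentation: operation symbols, their arities,
  and axioms. Arities are arbitrary index sets, so infinitary operations are allowed; the usual
  finitary case is \<open>arity P f = {..<n}\<close>. An axiom is an implication whose premises form a set of
  equations and whose conclusion is an equation; a plain equation is the case of no premises.
  The objects are all models of the presentation, the morphisms all homomorphisms.
\<close>

datatype ('f, 'i, 'v) trm = Var 'v | App 'f "'i \<Rightarrow> ('f, 'i, 'v) trm"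

type_synonym ('f, 'i, 'v) equation = "('f, 'i, 'v) trm \<times> ('f, 'i, 'v) trm"

record ('f, 'i, 'v) presentation =
  syms :: "'f set"
  arity :: "'f \<Rightarrow> 'i set"
  axms :: "(('f, 'i, 'v) equation set \<times> ('f, 'i, 'v) equation) set"

text \<open>
  In \<open>App f t\<close> only the subterms \<open>t i\<close> with \<open>i \<in> arity P f\<close> count; the others are ignored here and
  by \<open>eval\<close>.
\<close>

inductive wf_trm :: "('f, 'i, 'v) presentation \<Rightarrow> ('f, 'i, 'v) trm \<Rightarrow> bool" for P where
  "wf_trm P (Var v)"
| "\<lbrakk>f \<in> syms P; \<forall>i\<in>arity P f. wf_trm P (t i)\<rbrakk> \<Longrightarrow> wf_trm P (App f t)"

definition wf_presentation :: "('f, 'i, 'v) presentation \<Rightarrow> bool" where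
  "wf_presentation P \<longleftrightarrow>
     (\<forall>(\<Gamma>, e)\<in>axms P. \<forall>(l, r)\<in>insert e \<Gamma>. wf_trm P l \<and> wf_trm P r)"

text \<open>Carriers may be empty, as the spaces and hom-sets below may be.\<close>

record ('f, 'i, 'a) alg =
  carr :: "'a set"
  oper :: "'f \<Rightarrow> ('i \<Rightarrow> 'a) \<Rightarrow> 'a"

primrec eval ::
  "('f, 'i, 'v) presentation \<Rightarrow> ('f, 'i, 'a) alg \<Rightarrow> ('v \<Rightarrow> 'a) \<Rightarrow> ('f, 'i, 'v) trm \<Rightarrow> 'a"
where
  "eval P A v (Var x) = v x"
| "eval P A v (App f t) = oper A f (restrict (\<lambda>i. eval P A v (t i)) (arity P f))"

definition ualg :: "('f, 'i, 'v) presentation \<Rightarrow> ('f, 'i, 'a) alg \<Rightarrow> bool" where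
  "ualg P A \<longleftrightarrow>
     (\<forall>f\<in>syms P. oper A f \<in> (arity P f \<rightarrow>\<^sub>E carr A) \<rightarrow> carr A) \<and>
     (\<forall>(\<Gamma>, (l, r))\<in>axms P. \<forall>v. range v \<subseteq> carr A \<longrightarrow>
        (\<forall>(s, t)\<in>\<Gamma>. eval P A v s = eval P A v t) \<longrightarrow> eval P A v l = eval P A v r)"

text \<open>
  Morphisms (of algebras and of spaces) are extensional functions, so that each morphism is
  represented by exactly one element of the hom-set.
\<close>

definition alg_hom ::
  "('f, 'i, 'v) presentation \<Rightarrow> ('f, 'i, 'b) alg \<Rightarrow> ('f, 'i, 'a) alg \<Rightarrow> ('b \<Rightarrow> 'a) set"
where
  "alg_hom P B A = {h \<in> carr B \<rightarrow>\<^sub>E carr A.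
     \<forall>f\<in>syms P. \<forall>w \<in> arity P f \<rightarrow>\<^sub>E carr B.
       h (oper B f w) = oper A f (\<lambda>i\<in>arity P f. h (w i))}"

definition top_hom :: "'x topology \<Rightarrow> 'a topology \<Rightarrow> ('x \<Rightarrow> 'a) set" where
  "top_hom X Y = {u \<in> extensional (topspace X). continuous_map X Y u}"

text \<open>
  The forgetful functor on the algebras over type \<open>'b\<close> is represented by some \<open>F\<close>, which may live
  over another type: \<open>\<psi> B\<close> is a bijection between the homomorphisms \<open>F \<rightarrow> B\<close> and \<open>carr B\<close>,
  natural in \<open>B\<close>.
\<close>

definition forgetful_representable ::
  "'c itself \<Rightarrow> 'b itself \<Rightarrow> ('f, 'i, 'v) presentation \<Rightarrow> bool"
where
  "forgetful_representable (_ :: 'c itself) (_ :: 'b itself) P \<longleftrightarrow>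
     (\<exists>(F :: ('f, 'i, 'c) alg) (\<psi> :: ('f, 'i, 'b) alg \<Rightarrow> ('c \<Rightarrow> 'b) \<Rightarrow> 'b).
        ualg P F \<and>
        (\<forall>B. ualg P B \<longrightarrow> bij_betw (\<psi> B) (alg_hom P F B) (carr B)) \<and>
        (\<forall>B C. ualg P B \<longrightarrow> ualg P C \<longrightarrow>
           (\<forall>h\<in>alg_hom P B C. \<forall>k\<in>alg_hom P F B.
              \<psi> C (compose (carr F) h k) = h (\<psi> B k))))"

definition topological_algebra ::
  "('f, 'i, 'v) presentation \<Rightarrow> ('f, 'i, 'a) alg \<Rightarrow> 'a topology \<Rightarrow> bool"
where
  "topological_algebra P A Y \<longleftrightarrow>
     ualg P A \<and> topspace Y = carr A \<and>
     (\<forall>f\<in>syms P. continuous_map (product_topology (\<lambda>_. Y) (arity P f)) Y (oper A f))"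


section \<open>Initial structures and schizophrenic objects\<close>

text \<open>
  Since a formula cannot quantify over types, the type \<open>'x\<close> of the test spaces is a parameter.
\<close>

definition initial_topology ::
  "'x itself \<Rightarrow> 'h topology \<Rightarrow> 'j set \<Rightarrow> ('j \<Rightarrow> 'h \<Rightarrow> 'a) \<Rightarrow> 'a topology \<Rightarrow> bool"
where
  "initial_topology (_ :: 'x itself) H J ev Y \<longleftrightarrow>
     (\<forall>j\<in>J. continuous_map H Y (ev j)) \<and>
     (\<forall>(X :: 'x topology) g. g \<in> topspace X \<rightarrow> topspace H \<longrightarrow>
        (continuous_map X H g \<longleftrightarrow> (\<forall>j\<in>J. continuous_map X Y (ev j \<circ> g))))"

definition initial_algebra ::
  "'b itself \<Rightarrow> ('f, 'i, 'v) presentation \<Rightarrow> ('f, 'i, 'h) alg \<Rightarrow> 'j set \<Rightarrow> ('j \<Rightarrow> 'h \<Rightarrow> 'a)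
     \<Rightarrow> ('f, 'i, 'a) alg \<Rightarrow> bool"
where
  "initial_algebra (_ :: 'b itself) P H J ev A \<longleftrightarrow>
     (\<forall>j\<in>J. restrict (ev j) (carr H) \<in> alg_hom P H A) \<and>
     (\<forall>(B :: ('f, 'i, 'b) alg) g. ualg P B \<longrightarrow> g \<in> carr B \<rightarrow>\<^sub>E carr H \<longrightarrow>
        (g \<in> alg_hom P B H \<longleftrightarrow> (\<forall>j\<in>J. compose (carr B) (ev j) g \<in> alg_hom P B A)))"

text \<open>
  \<open>H\<close> is the set of homomorphisms \<open>B \<rightarrow> A\<close> with the initial topology for the evaluations. Test
  spaces over the type of \<open>H\<close> itself are included because they determine the topology uniquely,
  independently of \<open>'x\<close>.
\<close>

definition dual_space ::
  "'x itself \<Rightarrow> ('f, 'i, 'v) presentation \<Rightarrow> ('f, 'i, 'a) alg \<Rightarrow> 'a topology \<Rightarrow> ('f, 'i, 'b) alg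
     \<Rightarrow> ('b \<Rightarrow> 'a) topology \<Rightarrow> bool"
where
  "dual_space (_ :: 'x itself) P A Y B H \<longleftrightarrow>
     topspace H = alg_hom P B A \<and>
     initial_topology TYPE('x) H (carr B) (\<lambda>b h. h b) Y \<and>
     initial_topology TYPE('b \<Rightarrow> 'a) H (carr B) (\<lambda>b h. h b) Y"

definition dual_algebra ::
  "'b itself \<Rightarrow> ('f, 'i, 'v) presentation \<Rightarrow> ('f, 'i, 'a) alg \<Rightarrow> 'a topology \<Rightarrow> 'x topology
     \<Rightarrow> ('f, 'i, 'x \<Rightarrow> 'a) alg \<Rightarrow> bool"
where
  "dual_algebra (_ :: 'b itself) P A Y X H \<longleftrightarrow>
     ualg P H \<and>
     carr H = top_hom X Y \<and>
     (\<forall>f\<in>syms P. \<forall>w \<in> arity P f \<rightarrow>\<^sub>E carr H.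
        oper H f w = (\<lambda>x\<in>topspace X. oper A f (\<lambda>i\<in>arity P f. w i x))) \<and>
     initial_algebra TYPE('b) P H (topspace X) (\<lambda>x u. u x) A"

definition schizophrenic ::
  "'b itself \<Rightarrow> 'x itself \<Rightarrow> ('f, 'i, 'v) presentation \<Rightarrow> ('f, 'i, 'a) alg \<Rightarrow> 'a topology \<Rightarrow> bool"
where
  "schizophrenic (_ :: 'b itself) (_ :: 'x itself) P A Y \<longleftrightarrow>
     (\<forall>B :: ('f, 'i, 'b) alg. ualg P B \<longrightarrow> (\<exists>H. dual_space TYPE('x) P A Y B H)) \<and>
     (\<forall>X :: 'x topology. \<exists>H. dual_algebra TYPE('b) P A Y X H)"


section \<open>Natural dual adjunctions\<close>

text \<open>
  A contravariant functor between concrete categories. A category is given by its objects \<open>ob\<close>,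
  underlying sets \<open>U\<close> and hom-sets \<open>hom\<close> of extensional functions; a functor by its object map \<open>F\<close>
  and its morphism map, where \<open>Fm B C\<close> acts on the morphisms \<open>B \<rightarrow> C\<close>.
\<close>

definition contra_functor ::
  "('o \<Rightarrow> bool) \<Rightarrow> ('o \<Rightarrow> 'c set) \<Rightarrow> ('o \<Rightarrow> 'o \<Rightarrow> ('c \<Rightarrow> 'c) set) \<Rightarrow>
   ('p \<Rightarrow> bool) \<Rightarrow> ('p \<Rightarrow> 'd set) \<Rightarrow> ('p \<Rightarrow> 'p \<Rightarrow> ('d \<Rightarrow> 'd) set) \<Rightarrow>
   ('o \<Rightarrow> 'p) \<Rightarrow> ('o \<Rightarrow> 'o \<Rightarrow> ('c \<Rightarrow> 'c) \<Rightarrow> ('d \<Rightarrow> 'd)) \<Rightarrow> bool"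
where
  "contra_functor ob U hom ob' U' hom' F Fm \<longleftrightarrow>
     (\<forall>B. ob B \<longrightarrow> ob' (F B)) \<and>
     (\<forall>B C. ob B \<longrightarrow> ob C \<longrightarrow> (\<forall>h\<in>hom B C. Fm B C h \<in> hom' (F C) (F B))) \<and>
     (\<forall>B. ob B \<longrightarrow> Fm B B (\<lambda>x\<in>U B. x) = (\<lambda>y\<in>U' (F B). y)) \<and>
     (\<forall>B C D. ob B \<longrightarrow> ob C \<longrightarrow> ob D \<longrightarrow> (\<forall>h\<in>hom B C. \<forall>k\<in>hom C D.
        Fm B D (compose (U B) k h) = compose (U' (F D)) (Fm B C h) (Fm C D k)))"

text \<open>Precomposition with \<open>h\<close>, as a map on the hom-set \<open>M\<close>; \<open>D\<close> is the domain of \<open>h\<close>.\<close>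

definition precomp :: "('c \<Rightarrow> 'a) set \<Rightarrow> 'b set \<Rightarrow> ('b \<Rightarrow> 'c) \<Rightarrow> ('c \<Rightarrow> 'a) \<Rightarrow> ('b \<Rightarrow> 'a)" where
  "precomp M D h = (\<lambda>u\<in>M. compose D u h)"

text \<open>
  \<open>S\<close> and \<open>T\<close> are the object maps of the two functors, and \<open>\<phi> B X\<close> is the bijection from the
  homomorphisms \<open>B \<rightarrow> T X\<close> to the continuous maps \<open>X \<rightarrow> S B\<close>. The last conjunct is naturality in
  \<open>B\<close> and \<open>X\<close> jointly.
\<close>

definition natural_dual_adjunction ::
  "('f, 'i, 'v) presentation \<Rightarrow> ('f, 'i, 'a) alg \<Rightarrow> 'a topology
   \<Rightarrow> (('f, 'i, 'b) alg \<Rightarrow> ('b \<Rightarrow> 'a) topology)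
   \<Rightarrow> ('x topology \<Rightarrow> ('f, 'i, 'x \<Rightarrow> 'a) alg)
   \<Rightarrow> (('f, 'i, 'b) alg \<Rightarrow> 'x topology \<Rightarrow> ('b \<Rightarrow> 'x \<Rightarrow> 'a) \<Rightarrow> ('x \<Rightarrow> 'b \<Rightarrow> 'a)) \<Rightarrow> bool"
where
  "natural_dual_adjunction P A Y S T \<phi> \<longleftrightarrow>
     (let Sm = (\<lambda>B C. precomp (alg_hom P C A) (carr B));
          Tm = (\<lambda>X Z. precomp (top_hom Z Y) (topspace X))
      in
        contra_functor (ualg P) carr (alg_hom P) (\<lambda>_. True) topspace top_hom S Sm \<and>
        contra_functor (\<lambda>_. True) topspace top_hom (ualg P) carr (alg_hom P) T Tm \<and>
        (\<forall>B. ualg P B \<longrightarrow> dual_space TYPE('x) P A Y B (S B)) \<and>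
        (\<forall>X. dual_algebra TYPE('b) P A Y X (T X)) \<and>
        (\<forall>B X. ualg P B \<longrightarrow> bij_betw (\<phi> B X) (alg_hom P B (T X)) (top_hom X (S B))) \<and>
        (\<forall>B B' X X'. ualg P B \<longrightarrow> ualg P B' \<longrightarrow>
           (\<forall>h\<in>alg_hom P B' B. \<forall>u\<in>top_hom X' X. \<forall>k\<in>alg_hom P B (T X).
              \<phi> B' X' (compose (carr B') (Tm X' X u) (compose (carr B') k h)) =
              compose (topspace X') (Sm B' B h) (compose (topspace X') (\<phi> B X k) u))))"

end

theory Submission
  imports Defs
begin

text \<open>
  Both structures live on sets of \<open>A\<close>-valued functions. The homomorphisms \<open>B \<rightarrow> A\<close> form a subset
  of the power \<open>carr A ^ carr B\<close> and receive the subspace topology of the product topology; the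
  universal property of products and subspaces is the required initiality. The continuous maps
  \<open>X \<rightarrow> Y\<close> form a subset of the power \<open>carr A ^ topspace X\<close>. It is closed under the pointwise
  operations, since the pointwise operation is the composite of the tuple map into \<open>Y ^ arity\<close> with
  the continuous operation of \<open>A\<close>. It is again a model of the presentation because the
  evaluations at points are homomorphisms to \<open>A\<close> that jointly separate elements, and implications
  between equations are inherited along such families (\<open>ualg_if_jointly_injective\<close>): each premise
  is sent to a true equation in \<open>A\<close>, and the conclusion is reflected.

  With these structures, a homomorphism from \<open>B\<close> to the algebra of continuous maps and a continuous
  map from \<open>X\<close> to the space of homomorphisms are the same thing, namely a function of two variables
  \<open>b\<close> and \<open>x\<close> that is a homomorphism in \<open>b\<close> and continuous in \<open>x\<close>
  (\<open>alg_hom_pointwise_iff\<close>, \<open>top_hom_hom_space_iff\<close>). The adjunction therefore exchanges the two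
  arguments, and functoriality and naturality reduce to associativity of composition.
\<close>

section \<open>Homomorphisms and jointly injective families\<close>

lemma alg_homI:
  assumes "h \<in> carr B \<rightarrow>\<^sub>E carr A"
    and "\<And>f w. f \<in> syms P \<Longrightarrow> w \<in> arity P f \<rightarrow>\<^sub>E carr B \<Longrightarrow>
           h (oper B f w) = oper A f (\<lambda>i\<in>arity P f. h (w i))"
  shows "h \<in> alg_hom P B A"
  using assms by (simp add: alg_hom_def)

lemma alg_hom_oper:
  assumes "h \<in> alg_hom P B A" "f \<in> syms P" "w \<in> arity P f \<rightarrow>\<^sub>E carr B"
  shows "h (oper B f w) = oper A f (\<lambda>i\<in>arity P f. h (w i))"
  using assms by (simp add: alg_hom_def)

lemma alg_hom_PiE: "h \<in> alg_hom P B A \<Longrightarrow> h \<in> carr B \<rightarrow>\<^sub>E carr A"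
  by (simp add: alg_hom_def)

lemma alg_hom_mem: "h \<in> alg_hom P B A \<Longrightarrow> b \<in> carr B \<Longrightarrow> h b \<in> carr A"
  by (blast dest: alg_hom_PiE PiE_mem)

lemma ualg_oper:
  assumes "ualg P A" "f \<in> syms P" "w \<in> arity P f \<rightarrow>\<^sub>E carr A"
  shows "oper A f w \<in> carr A"
  using assms by (auto simp: ualg_def)

lemma alg_hom_compose:
  assumes h: "h \<in> alg_hom P B C" and k: "k \<in> alg_hom P C D" and B: "ualg P B"
  shows "compose (carr B) k h \<in> alg_hom P B D"
proof (rule alg_homI)
  show "compose (carr B) k h \<in> carr B \<rightarrow>\<^sub>E carr D"
    using alg_hom_mem[OF h] alg_hom_mem[OF k] by (auto simp: compose_def)
next
  fix f w assume f: "f \<in> syms P" and w: "w \<in> arity P f \<rightarrow>\<^sub>E carr B"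
  have hw: "(\<lambda>i\<in>arity P f. h (w i)) \<in> arity P f \<rightarrow>\<^sub>E carr C"
    using w alg_hom_mem[OF h] by auto
  have "compose (carr B) k h (oper B f w) = k (oper C f (\<lambda>i\<in>arity P f. h (w i)))"
    using alg_hom_oper[OF h f w] ualg_oper[OF B f w] by (simp add: compose_def)
  also have "\<dots> = oper D f (\<lambda>i\<in>arity P f. k ((\<lambda>i\<in>arity P f. h (w i)) i))"
    by (rule alg_hom_oper[OF k f hw])
  also have "(\<lambda>i\<in>arity P f. k ((\<lambda>i\<in>arity P f. h (w i)) i)) =
      (\<lambda>i\<in>arity P f. compose (carr B) k h (w i))"
    using w by (intro restrict_ext) (auto simp: compose_def)
  finally show "compose (carr B) k h (oper B f w) =
      oper D f (\<lambda>i\<in>arity P f. compose (carr B) k h (w i))" .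
qed

lemma eval_in_carr:
  assumes "wf_trm P t"
    and closed: "\<And>f w. f \<in> syms P \<Longrightarrow> w \<in> arity P f \<rightarrow>\<^sub>E carr H \<Longrightarrow> oper H f w \<in> carr H"
    and "range v \<subseteq> carr H"
  shows "eval P H v t \<in> carr H"
  using assms(1)
proof induction
  case (1 x)
  then show ?case using assms(3) by auto
next
  case (2 f t)
  then have "(\<lambda>i\<in>arity P f. eval P H v (t i)) \<in> arity P f \<rightarrow>\<^sub>E carr H"
    by auto
  with 2 closed show ?case by simp
qed

lemma alg_hom_eval:
  assumes h: "h \<in> alg_hom P H A" and "wf_trm P t"
    and closed: "\<And>f w. f \<in> syms P \<Longrightarrow> w \<in> arity P f \<rightarrow>\<^sub>E carr H \<Longrightarrow> oper H f w \<in> carr H"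
    and v: "range v \<subseteq> carr H"
  shows "h (eval P H v t) = eval P A (h \<circ> v) t"
  using assms(2)
proof induction
  case (1 x)
  then show ?case by simp
next
  case (2 f t)
  have "(\<lambda>i\<in>arity P f. eval P H v (t i)) \<in> arity P f \<rightarrow>\<^sub>E carr H"
    using 2 eval_in_carr[OF _ closed v] by auto
  then have "h (eval P H v (App f t)) =
      oper A f (\<lambda>i\<in>arity P f. h ((\<lambda>i\<in>arity P f. eval P H v (t i)) i))"
    using alg_hom_oper[OF h \<open>f \<in> syms P\<close>] by simp
  also have "(\<lambda>i\<in>arity P f. h ((\<lambda>i\<in>arity P f. eval P H v (t i)) i)) =
      (\<lambda>i\<in>arity P f. eval P A (h \<circ> v) (t i))"
    using 2 by (intro restrict_ext) (simp add: comp_def)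
  finally show ?case by (simp only: eval.simps)
qed

text \<open>
  A homomorphism carries a solution of the premises of an axiom in \<open>H\<close> to a solution in \<open>A\<close>, where
  the conclusion then holds; joint injectivity brings the conclusion back. This is closure of a
  quasivariety under subobjects of powers, with the empty power included.
\<close>

lemma ualg_if_jointly_injective:
  assumes wf: "wf_presentation P" and A: "ualg P A"
    and closed: "\<And>f w. f \<in> syms P \<Longrightarrow> w \<in> arity P f \<rightarrow>\<^sub>E carr H \<Longrightarrow> oper H f w \<in> carr H"
    and hom: "\<And>j. j \<in> J \<Longrightarrow> h j \<in> alg_hom P H A"
    and inj: "\<And>a b. a \<in> carr H \<Longrightarrow> b \<in> carr H \<Longrightarrow> (\<And>j. j \<in> J \<Longrightarrow> h j a = h j b) \<Longrightarrow> a = b"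
  shows "ualg P H"
proof -
  have "eval P H v l = eval P H v r"
    if ax: "(\<Gamma>, (l, r)) \<in> axms P" and v: "range v \<subseteq> carr H"
      and prem: "\<forall>(s, t)\<in>\<Gamma>. eval P H v s = eval P H v t" for \<Gamma> l r v
  proof (rule inj)
    have wfs: "wf_trm P s \<and> wf_trm P t" if "(s, t) \<in> insert (l, r) \<Gamma>" for s t
      using bspec[OF wf[unfolded wf_presentation_def] ax] that by auto
    then have wl: "wf_trm P l" and wr: "wf_trm P r" by blast+
    show "eval P H v l \<in> carr H" "eval P H v r \<in> carr H"
      by (rule eval_in_carr[OF wl closed v], assumption+)
        (rule eval_in_carr[OF wr closed v], assumption+)
    fix j assume j: "j \<in> J"
    note ev = alg_hom_eval[OF hom[OF j] _ closed v]
    have jv: "range (h j \<circ> v) \<subseteq> carr A"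
      using v alg_hom_mem[OF hom[OF j]] by auto
    have "eval P A (h j \<circ> v) s = eval P A (h j \<circ> v) t" if "(s, t) \<in> \<Gamma>" for s t
    proof -
      have "wf_trm P s" "wf_trm P t" using wfs that by blast+
      moreover have "eval P H v s = eval P H v t" using prem that by blast
      ultimately show ?thesis using ev[of s] ev[of t] by simp
    qed
    moreover have "\<forall>v. range v \<subseteq> carr A \<longrightarrow>
        (\<forall>(s, t)\<in>\<Gamma>. eval P A v s = eval P A v t) \<longrightarrow> eval P A v l = eval P A v r"
      using bspec[OF conjunct2[OF A[unfolded ualg_def]] ax] by simp
    note mp[OF spec[OF this] jv]
    ultimately have "eval P A (h j \<circ> v) l = eval P A (h j \<circ> v) r"
      by auto
    then show "h j (eval P H v l) = h j (eval P H v r)"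
      using ev[OF wl] ev[OF wr] by simp
  qed
  then show ?thesis
    unfolding ualg_def by (intro conjI ballI funcsetI closed) (assumption | clarify)+
qed

text \<open>
  Joint injectivity also makes a family of homomorphisms initial: the two sides of the
  homomorphism condition for \<open>g\<close> can be compared after applying every member of the family.
\<close>

lemma alg_hom_iff_jointly_injective:
  assumes B: "ualg P B"
    and closed: "\<And>f w. f \<in> syms P \<Longrightarrow> w \<in> arity P f \<rightarrow>\<^sub>E carr H \<Longrightarrow> oper H f w \<in> carr H"
    and hom: "\<And>j. j \<in> J \<Longrightarrow> h j \<in> alg_hom P H A"
    and inj: "\<And>a b. a \<in> carr H \<Longrightarrow> b \<in> carr H \<Longrightarrow> (\<And>j. j \<in> J \<Longrightarrow> h j a = h j b) \<Longrightarrow> a = b"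
    and g: "g \<in> carr B \<rightarrow>\<^sub>E carr H"
  shows "g \<in> alg_hom P B H \<longleftrightarrow> (\<forall>j\<in>J. compose (carr B) (h j) g \<in> alg_hom P B A)"
proof
  assume "g \<in> alg_hom P B H"
  then show "\<forall>j\<in>J. compose (carr B) (h j) g \<in> alg_hom P B A"
    using alg_hom_compose hom B by blast
next
  assume comp: "\<forall>j\<in>J. compose (carr B) (h j) g \<in> alg_hom P B A"
  show "g \<in> alg_hom P B H"
  proof (rule alg_homI[OF g])
    fix f w assume f: "f \<in> syms P" and w: "w \<in> arity P f \<rightarrow>\<^sub>E carr B"
    have gw: "(\<lambda>i\<in>arity P f. g (w i)) \<in> arity P f \<rightarrow>\<^sub>E carr H"
      using g w by auto
    show "g (oper B f w) = oper H f (\<lambda>i\<in>arity P f. g (w i))"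
    proof (rule inj)
      show "g (oper B f w) \<in> carr H"
        using g ualg_oper[OF B f w] by auto
      show "oper H f (\<lambda>i\<in>arity P f. g (w i)) \<in> carr H"
        by (rule closed[OF f gw])
      fix j assume j: "j \<in> J"
      have "h j (g (oper B f w)) = compose (carr B) (h j) g (oper B f w)"
        using ualg_oper[OF B f w] by (simp add: compose_def)
      also have "\<dots> = oper A f (\<lambda>i\<in>arity P f. compose (carr B) (h j) g (w i))"
        using comp j by (blast intro: alg_hom_oper[OF _ f w])
      also have "(\<lambda>i\<in>arity P f. compose (carr B) (h j) g (w i)) =
          (\<lambda>i\<in>arity P f. h j ((\<lambda>i\<in>arity P f. g (w i)) i))"
        using w by (intro restrict_ext) (auto simp: compose_def)
      also have "oper A f \<dots> = h j (oper H f (\<lambda>i\<in>arity P f. g (w i)))"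
        by (rule alg_hom_oper[OF hom[OF j] f gw, symmetric])
      finally show "h j (g (oper B f w)) = h j (oper H f (\<lambda>i\<in>arity P f. g (w i)))" .
    qed
  qed
qed


section \<open>The space of homomorphisms\<close>

definition hom_space ::
  "('f, 'i, 'v) presentation \<Rightarrow> ('f, 'i, 'a) alg \<Rightarrow> 'a topology \<Rightarrow> ('f, 'i, 'b) alg
     \<Rightarrow> ('b \<Rightarrow> 'a) topology"
where
  "hom_space P A Y B = subtopology (product_topology (\<lambda>_. Y) (carr B)) (alg_hom P B A)"

lemma topspace_hom_space:
  assumes "topspace Y = carr A"
  shows "topspace (hom_space P A Y B) = alg_hom P B A"
  using assms by (auto simp: hom_space_def dest: alg_hom_PiE)

lemma continuous_map_hom_space_iff:
  assumes "topspace Y = carr A"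
  shows "continuous_map X (hom_space P A Y B) g \<longleftrightarrow>
    g \<in> topspace X \<rightarrow> alg_hom P B A \<and> (\<forall>b\<in>carr B. continuous_map X Y (\<lambda>x. g x b))"
proof -
  have "g ` topspace X \<subseteq> extensional (carr B)" if "g \<in> topspace X \<rightarrow> alg_hom P B A"
    using that by (fastforce dest: alg_hom_PiE simp: PiE_def)
  then show ?thesis
    by (auto simp: hom_space_def continuous_map_in_subtopology continuous_map_componentwise)
qed

lemma initial_topology_hom_space:
  assumes "topspace Y = carr A"
  shows "initial_topology TYPE('x) (hom_space P A Y B) (carr B) (\<lambda>b h. h b) Y"
proof -
  have "\<forall>b\<in>carr B. continuous_map (hom_space P A Y B) Y (\<lambda>h. h b)"
    using continuous_map_hom_space_iff[OF assms, of "hom_space P A Y B" P B id] by simp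
  then show ?thesis
    unfolding initial_topology_def
    by (auto simp: continuous_map_hom_space_iff[OF assms] topspace_hom_space[OF assms] comp_def)
qed

lemma dual_space_hom_space:
  assumes "topspace Y = carr A"
  shows "dual_space TYPE('x) P A Y B (hom_space P A Y B)"
  by (simp add: dual_space_def topspace_hom_space[OF assms] initial_topology_hom_space[OF assms])


section \<open>The algebra of continuous maps\<close>

definition pointwise_algebra ::
  "('f, 'i, 'v) presentation \<Rightarrow> ('f, 'i, 'a) alg \<Rightarrow> 'a topology \<Rightarrow> 'x topology
     \<Rightarrow> ('f, 'i, 'x \<Rightarrow> 'a) alg"
where
  "pointwise_algebra P A Y X =
     \<lparr>carr = top_hom X Y,
      oper = (\<lambda>f w. \<lambda>x\<in>topspace X. oper A f (\<lambda>i\<in>arity P f. w i x))\<rparr>"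

lemma carr_pointwise_algebra [simp]: "carr (pointwise_algebra P A Y X) = top_hom X Y"
  by (simp add: pointwise_algebra_def)

lemma oper_pointwise_algebra [simp]:
  "oper (pointwise_algebra P A Y X) f w =
     (\<lambda>x\<in>topspace X. oper A f (\<lambda>i\<in>arity P f. w i x))"
  by (simp add: pointwise_algebra_def)

lemma restrict_in_top_hom_iff: "restrict u (topspace X) \<in> top_hom X Y \<longleftrightarrow> continuous_map X Y u"
  by (auto simp: top_hom_def intro: continuous_map_eq)

lemma top_hom_mem: "u \<in> top_hom X Y \<Longrightarrow> x \<in> topspace X \<Longrightarrow> u x \<in> topspace Y"
  by (auto simp: top_hom_def dest: continuous_map_funspace)

lemma top_hom_eqI:
  assumes "u \<in> top_hom X Y" "v \<in> top_hom X Y" "\<And>x. x \<in> topspace X \<Longrightarrow> u x = v x"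
  shows "u = v"
  using assms by (auto simp: top_hom_def intro: extensionalityI)

lemma top_hom_compose:
  assumes "u \<in> top_hom X Z" "v \<in> top_hom Z Y"
  shows "compose (topspace X) v u \<in> top_hom X Y"
proof -
  have "continuous_map X Y (v \<circ> u)"
    using assms by (auto simp: top_hom_def intro: continuous_map_compose)
  then show ?thesis
    by (simp add: compose_def restrict_in_top_hom_iff comp_def)
qed

lemma pointwise_algebra_closed:
  assumes "continuous_map (product_topology (\<lambda>_. Y) (arity P f)) Y (oper A f)"
    and "w \<in> arity P f \<rightarrow>\<^sub>E top_hom X Y"
  shows "oper (pointwise_algebra P A Y X) f w \<in> top_hom X Y"
proof -
  have "continuous_map X (product_topology (\<lambda>_. Y) (arity P f)) (\<lambda>x. \<lambda>i\<in>arity P f. w i x)"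
    using assms(2) by (auto simp: continuous_map_componentwise top_hom_def)
  then have "continuous_map X Y (oper A f \<circ> (\<lambda>x. \<lambda>i\<in>arity P f. w i x))"
    using assms(1) by (rule continuous_map_compose)
  then show ?thesis
    by (simp add: restrict_in_top_hom_iff comp_def)
qed

text \<open>
  This holds by the definition of the pointwise operations. Continuity of the operations of \<open>A\<close>
  still enters: the evaluation is undefined outside \<open>top_hom X Y\<close>, so the result of a pointwise
  operation has to be known to be continuous.
\<close>

lemma evaluation_alg_hom:
  assumes top: "topological_algebra P A Y" and x: "x \<in> topspace X"
  shows "(\<lambda>u\<in>top_hom X Y. u x) \<in> alg_hom P (pointwise_algebra P A Y X) A"
proof (rule alg_homI)
  show "(\<lambda>u\<in>top_hom X Y. u x) \<in> carr (pointwise_algebra P A Y X) \<rightarrow>\<^sub>E carr A"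
    using top top_hom_mem[OF _ x, of _ Y] by (auto simp: topological_algebra_def)
next
  fix f w assume f: "f \<in> syms P" and "w \<in> arity P f \<rightarrow>\<^sub>E carr (pointwise_algebra P A Y X)"
  then have w: "w \<in> arity P f \<rightarrow>\<^sub>E top_hom X Y" by simp
  have "oper (pointwise_algebra P A Y X) f w \<in> top_hom X Y"
    using top f by (intro pointwise_algebra_closed[OF _ w]) (simp add: topological_algebra_def)
  then have "(\<lambda>u\<in>top_hom X Y. u x) (oper (pointwise_algebra P A Y X) f w) =
      oper A f (\<lambda>i\<in>arity P f. w i x)"
    using x by simp
  also have "(\<lambda>i\<in>arity P f. w i x) = (\<lambda>i\<in>arity P f. (\<lambda>u\<in>top_hom X Y. u x) (w i))"
    using w by (intro restrict_ext) auto
  finally show "(\<lambda>u\<in>top_hom X Y. u x) (oper (pointwise_algebra P A Y X) f w) =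
      oper A f (\<lambda>i\<in>arity P f. (\<lambda>u\<in>top_hom X Y. u x) (w i))" .
qed

lemma ualg_pointwise_algebra:
  assumes "wf_presentation P" and top: "topological_algebra P A Y"
  shows "ualg P (pointwise_algebra P A Y X)"
proof (rule ualg_if_jointly_injective[OF assms(1)])
  show "ualg P A" using top by (simp add: topological_algebra_def)
  show "(\<lambda>u\<in>top_hom X Y. u x) \<in> alg_hom P (pointwise_algebra P A Y X) A"
    if "x \<in> topspace X" for x
    by (rule evaluation_alg_hom[OF top that])
  show "oper (pointwise_algebra P A Y X) f w \<in> carr (pointwise_algebra P A Y X)"
    if "f \<in> syms P" "w \<in> arity P f \<rightarrow>\<^sub>E carr (pointwise_algebra P A Y X)" for f w
    using pointwise_algebra_closed[of Y P f A w X] that top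
    by (simp add: topological_algebra_def)
qed (auto intro: top_hom_eqI)

lemma alg_hom_pointwise_initial:
  assumes top: "topological_algebra P A Y" and B: "ualg P B"
    and g: "g \<in> carr B \<rightarrow>\<^sub>E top_hom X Y"
  shows "g \<in> alg_hom P B (pointwise_algebra P A Y X) \<longleftrightarrow>
    (\<forall>x\<in>topspace X. (\<lambda>b\<in>carr B. g b x) \<in> alg_hom P B A)"
proof -
  have "g \<in> alg_hom P B (pointwise_algebra P A Y X) \<longleftrightarrow>
    (\<forall>x\<in>topspace X. compose (carr B) (\<lambda>u\<in>top_hom X Y. u x) g \<in> alg_hom P B A)"
  proof (rule alg_hom_iff_jointly_injective[OF B])
    show "(\<lambda>u\<in>top_hom X Y. u x) \<in> alg_hom P (pointwise_algebra P A Y X) A"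
      if "x \<in> topspace X" for x
      by (rule evaluation_alg_hom[OF top that])
    show "oper (pointwise_algebra P A Y X) f w \<in> carr (pointwise_algebra P A Y X)"
      if "f \<in> syms P" "w \<in> arity P f \<rightarrow>\<^sub>E carr (pointwise_algebra P A Y X)" for f w
      using pointwise_algebra_closed[of Y P f A w X] that top
      by (simp add: topological_algebra_def)
  qed (use g in \<open>auto intro: top_hom_eqI\<close>)
  moreover have "compose (carr B) (\<lambda>u\<in>top_hom X Y. u x) g = (\<lambda>b\<in>carr B. g b x)" for x
    unfolding compose_def using g by (intro restrict_ext) auto
  ultimately show ?thesis by simp
qed

lemma dual_algebra_pointwise_algebra:
  assumes "wf_presentation P" and top: "topological_algebra P A Y"
  shows "dual_algebra TYPE('b) P A Y X (pointwise_algebra P A Y X)"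
  using ualg_pointwise_algebra[OF assms, of X] evaluation_alg_hom[OF top, of _ X]
  by (simp add: dual_algebra_def initial_algebra_def compose_def alg_hom_pointwise_initial[OF top])


section \<open>The dual adjunction\<close>

lemma alg_hom_pointwise_iff:
  assumes "topological_algebra P A Y" "ualg P B"
  shows "k \<in> alg_hom P B (pointwise_algebra P A Y X) \<longleftrightarrow>
    k \<in> carr B \<rightarrow>\<^sub>E top_hom X Y \<and> (\<forall>x\<in>topspace X. (\<lambda>b\<in>carr B. k b x) \<in> alg_hom P B A)"
  using alg_hom_pointwise_initial[OF assms, of k X]
    alg_hom_PiE[of k P B "pointwise_algebra P A Y X"] by auto

lemma top_hom_hom_space_iff:
  assumes "topspace Y = carr A"
  shows "l \<in> top_hom X (hom_space P A Y B) \<longleftrightarrow>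
    l \<in> topspace X \<rightarrow>\<^sub>E alg_hom P B A \<and> (\<forall>b\<in>carr B. (\<lambda>x\<in>topspace X. l x b) \<in> top_hom X Y)"
  unfolding restrict_in_top_hom_iff
  by (auto simp: top_hom_def continuous_map_hom_space_iff[OF assms] PiE_def)

definition swap_args :: "'b set \<Rightarrow> 'x set \<Rightarrow> ('b \<Rightarrow> 'x \<Rightarrow> 'a) \<Rightarrow> ('x \<Rightarrow> 'b \<Rightarrow> 'a)" where
  "swap_args D E k = (\<lambda>x\<in>E. \<lambda>b\<in>D. k b x)"

lemma swap_args_swap_args:
  assumes "k \<in> D \<rightarrow>\<^sub>E extensional E"
  shows "swap_args E D (swap_args D E k) = k"
proof (intro ext)
  fix b x
  show "swap_args E D (swap_args D E k) b x = k b x"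
    using PiE_arb[OF assms, of b] PiE_mem[OF assms, of b]
    by (auto simp: swap_args_def extensional_def restrict_def)
qed

text \<open>
  The descriptions of the two hom-sets in \<open>alg_hom_pointwise_iff\<close> and \<open>top_hom_hom_space_iff\<close> are
  mirror images: a homomorphism in one argument and a continuous map in the other. The two exchanges
  are mutually inverse because all functions involved are extensional in both arguments.
\<close>

lemma swap_args_bij_betw:
  fixes A :: "('f, 'i, 'a) alg" and B :: "('f, 'i, 'b) alg" and X :: "'x topology"
  assumes top: "topological_algebra P A Y" and B: "ualg P B"
  shows "bij_betw (swap_args (carr B) (topspace X))
    (alg_hom P B (pointwise_algebra P A Y X)) (top_hom X (hom_space P A Y B))"
proof -
  have Y: "topspace Y = carr A" using top by (simp add: topological_algebra_def)
  note hom_iff = alg_hom_pointwise_iff[OF top B, of _ X]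
    and cont_iff = top_hom_hom_space_iff[OF Y, of _ X P B]
  have fibre: "k \<in> carr B \<rightarrow>\<^sub>E extensional (topspace X)"
    if "k \<in> alg_hom P B (pointwise_algebra P A Y X)" for k
  proof -
    have "k \<in> carr B \<rightarrow>\<^sub>E top_hom X Y" using that hom_iff by simp
    moreover have "top_hom X Y \<subseteq> extensional (topspace X)" by (auto simp: top_hom_def)
    ultimately show ?thesis using PiE_mono by blast
  qed
  have fibre': "l \<in> topspace X \<rightarrow>\<^sub>E extensional (carr B)"
    if "l \<in> top_hom X (hom_space P A Y B)" for l
  proof -
    have "l \<in> topspace X \<rightarrow>\<^sub>E alg_hom P B A" using that cont_iff by simp
    moreover have "alg_hom P B A \<subseteq> extensional (carr B)" by (auto simp: alg_hom_def PiE_def)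
    ultimately show ?thesis using PiE_mono by blast
  qed
  \<comment> \<open>The slices of the exchanged function are the values of the original one, so the condition on
    slices and the condition on values in \<open>hom_iff\<close> and \<open>cont_iff\<close> trade places.\<close>
  have slice: "(\<lambda>x\<in>topspace X. swap_args (carr B) (topspace X) k x b) = k b"
    if "k \<in> carr B \<rightarrow>\<^sub>E extensional (topspace X)" "b \<in> carr B" for k :: "'b \<Rightarrow> 'x \<Rightarrow> 'a" and b
    using PiE_mem[OF that] that(2) by (auto simp: swap_args_def extensional_def restrict_def)
  have slice': "(\<lambda>b\<in>carr B. swap_args (topspace X) (carr B) l b x) = l x"
    if "l \<in> topspace X \<rightarrow>\<^sub>E extensional (carr B)" "x \<in> topspace X" for l :: "'x \<Rightarrow> 'b \<Rightarrow> 'a" and x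
    using PiE_mem[OF that] that(2) by (auto simp: swap_args_def extensional_def restrict_def)
  have to: "swap_args (carr B) (topspace X) k \<in> top_hom X (hom_space P A Y B)"
    if k: "k \<in> alg_hom P B (pointwise_algebra P A Y X)" for k
  proof -
    have "swap_args (carr B) (topspace X) k \<in> topspace X \<rightarrow>\<^sub>E alg_hom P B A"
      using k unfolding hom_iff swap_args_def by auto
    moreover have "k b \<in> top_hom X Y" if "b \<in> carr B" for b
      using k that unfolding hom_iff by auto
    ultimately show ?thesis
      unfolding cont_iff using slice[OF fibre[OF k]] by simp
  qed
  have fro: "swap_args (topspace X) (carr B) l \<in> alg_hom P B (pointwise_algebra P A Y X)"
    if l: "l \<in> top_hom X (hom_space P A Y B)" for l
  proof -
    have "swap_args (topspace X) (carr B) l \<in> carr B \<rightarrow>\<^sub>E top_hom X Y"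
      using l unfolding cont_iff swap_args_def by auto
    moreover have "l x \<in> alg_hom P B A" if "x \<in> topspace X" for x
      using l that unfolding cont_iff by auto
    ultimately show ?thesis
      unfolding hom_iff using slice'[OF fibre'[OF l]] by simp
  qed
  show ?thesis
    by (rule bij_betw_byWitness[where f' = "swap_args (topspace X) (carr B)"])
      (auto simp: to fro swap_args_swap_args[OF fibre] swap_args_swap_args[OF fibre'])
qed

lemma contra_functor_hom_space:
  fixes P :: "('f, 'i, 'v) presentation"
  assumes Y: "topspace Y = carr A"
  shows "contra_functor (ualg P) carr (alg_hom P) (\<lambda>_. True) topspace top_hom
    (hom_space P A Y) (\<lambda>B C. precomp (alg_hom P C A) (carr B))"
proof -
  note ts = topspace_hom_space[OF Y]
  have mor: "precomp (alg_hom P C A) (carr B) h \<in> top_hom (hom_space P A Y C) (hom_space P A Y B)"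
    if B: "ualg P B" and h: "h \<in> alg_hom P B C" for B C :: "('f, 'i, 'b) alg" and h
  proof -
    have "continuous_map (hom_space P A Y C) Y (\<lambda>u. u c)" if "c \<in> carr C" for c
      using continuous_map_hom_space_iff[OF Y, of "hom_space P A Y C" P C id] that by simp
    then have "continuous_map (hom_space P A Y C) (hom_space P A Y B) (\<lambda>u. compose (carr B) u h)"
      using alg_hom_compose[OF h _ B] alg_hom_mem[OF h]
      by (auto simp: continuous_map_hom_space_iff[OF Y] ts compose_def)
    then show ?thesis
      unfolding precomp_def ts[of P C, symmetric] restrict_in_top_hom_iff .
  qed
  have ident: "precomp (alg_hom P B A) (carr B) (\<lambda>x\<in>carr B. x) = (\<lambda>u\<in>alg_hom P B A. u)"
    for B :: "('f, 'i, 'b) alg"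
    unfolding precomp_def
    by (rule restrict_ext) (auto simp: compose_def alg_hom_def PiE_def extensional_def)
  have comp: "precomp (alg_hom P D A) (carr B) (compose (carr B) k h) =
      compose (alg_hom P D A) (precomp (alg_hom P C A) (carr B) h)
        (precomp (alg_hom P D A) (carr C) k)"
    if "ualg P C" "h \<in> alg_hom P B C" "k \<in> alg_hom P C D"
    for B C D :: "('f, 'i, 'b) alg" and h k
    using that alg_hom_compose[OF that(3) _ that(1)] alg_hom_mem[OF that(2)]
    by (auto simp: precomp_def compose_def fun_eq_iff)
  show ?thesis
    unfolding contra_functor_def ts using mor ident comp by blast
qed

lemma contra_functor_pointwise_algebra:
  assumes wf: "wf_presentation P" and top: "topological_algebra P A Y"
  shows "contra_functor (\<lambda>_. True) topspace top_hom (ualg P) carr (alg_hom P)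
    (pointwise_algebra P A Y) (\<lambda>X Z. precomp (top_hom Z Y) (topspace X))"
proof -
  have mor: "precomp (top_hom Z Y) (topspace X) u
      \<in> alg_hom P (pointwise_algebra P A Y Z) (pointwise_algebra P A Y X)"
    if u: "u \<in> top_hom X Z" for X Z :: "'x topology" and u
    unfolding alg_hom_pointwise_iff[OF top ualg_pointwise_algebra[OF wf top]]
  proof (intro conjI ballI)
    show "precomp (top_hom Z Y) (topspace X) u \<in>
        carr (pointwise_algebra P A Y Z) \<rightarrow>\<^sub>E top_hom X Y"
      using top_hom_compose[OF u] by (auto simp: precomp_def)
    fix x assume x: "x \<in> topspace X"
    \<comment> \<open>Evaluating \<open>v \<circ> u\<close> at \<open>x\<close> is evaluating \<open>v\<close> at \<open>u x\<close>.\<close>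
    have "(\<lambda>v\<in>carr (pointwise_algebra P A Y Z). precomp (top_hom Z Y) (topspace X) u v x) =
        (\<lambda>v\<in>top_hom Z Y. v (u x))"
      using x by (auto simp: precomp_def compose_def)
    then show "(\<lambda>v\<in>carr (pointwise_algebra P A Y Z). precomp (top_hom Z Y) (topspace X) u v x)
        \<in> alg_hom P (pointwise_algebra P A Y Z) A"
      using evaluation_alg_hom[OF top top_hom_mem[OF u x]] by simp
  qed
  have ident: "precomp (top_hom X Y) (topspace X) (\<lambda>x\<in>topspace X. x) = (\<lambda>v\<in>top_hom X Y. v)"
    for X :: "'x topology"
    unfolding precomp_def
    by (rule restrict_ext) (auto simp: compose_def top_hom_def extensional_def)
  have comp: "precomp (top_hom W Y) (topspace X) (compose (topspace X) v u) =
      compose (top_hom W Y) (precomp (top_hom Z Y) (topspace X) u)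
        (precomp (top_hom W Y) (topspace Z) v)"
    if "u \<in> top_hom X Z" "v \<in> top_hom Z W" for X Z W :: "'x topology" and u v
    using that top_hom_compose[OF that(2)] top_hom_mem[OF that(1)]
    by (auto simp: precomp_def compose_def fun_eq_iff)
  show ?thesis
    unfolding contra_functor_def carr_pointwise_algebra
    using ualg_pointwise_algebra[OF wf top] mor ident comp by blast
qed

text \<open>Both sides are the function sending \<open>x\<close> and \<open>b\<close> to \<open>k (h b) (u x)\<close>.\<close>

lemma swap_args_natural:
  assumes "h \<in> D' \<rightarrow> D" "u \<in> E' \<rightarrow> E" "k \<in> D \<rightarrow> M"
    and "\<And>x. x \<in> E \<Longrightarrow> (\<lambda>b\<in>D. k b x) \<in> N"
  shows "swap_args D' E' (compose D' (precomp M E' u) (compose D' k h)) =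
    compose E' (precomp N D' h) (compose E' (swap_args D E k) u)"
proof (intro ext)
  fix x b
  have "k (h b) \<in> M" "h b \<in> D" if "b \<in> D'" using assms that by auto
  moreover have "u x \<in> E" "(\<lambda>b\<in>D. k b (u x)) \<in> N" if "x \<in> E'" using assms that by auto
  ultimately show "swap_args D' E' (compose D' (precomp M E' u) (compose D' k h)) x b =
      compose E' (precomp N D' h) (compose E' (swap_args D E k) u) x b"
    by (simp add: swap_args_def compose_def precomp_def restrict_def)
qed

lemma natural_dual_adjunction_swap_args:
  assumes wf: "wf_presentation P" and top: "topological_algebra P A Y"
  shows "natural_dual_adjunction P A Y (hom_space P A Y) (pointwise_algebra P A Y)
    (\<lambda>B X. swap_args (carr B) (topspace X))"
proof -
  have Y: "topspace Y = carr A" using top by (simp add: topological_algebra_def)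
  have natural: "swap_args (carr B') (topspace X')
      (compose (carr B') (precomp (top_hom X Y) (topspace X') u) (compose (carr B') k h)) =
      compose (topspace X') (precomp (alg_hom P B A) (carr B') h)
        (compose (topspace X') (swap_args (carr B) (topspace X) k) u)"
    if "ualg P B" "h \<in> alg_hom P B' B" "u \<in> top_hom X' X"
      "k \<in> alg_hom P B (pointwise_algebra P A Y X)" for B B' X X' h u k
    using that(4) unfolding alg_hom_pointwise_iff[OF top that(1)]
    by (intro swap_args_natural) (auto intro: alg_hom_mem[OF that(2)] top_hom_mem[OF that(3)])
  show ?thesis
    unfolding natural_dual_adjunction_def Let_def
    using contra_functor_hom_space[OF Y] contra_functor_pointwise_algebra[OF wf top]
      dual_space_hom_space[OF Y] dual_algebra_pointwise_algebra[OF wf top]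
      swap_args_bij_betw[OF top] natural
    by blast
qed

theorem proposition8p1:
  fixes P :: "('f, 'i, 'v) presentation"
    and A :: "('f, 'i, 'a) alg"
    and Y :: "'a topology"
  assumes "wf_presentation P"
    and "forgetful_representable TYPE('c) TYPE('b) P"
    and "topological_algebra P A Y"
  shows "schizophrenic TYPE('b) TYPE('x) P A Y \<and>
    (\<exists>(S :: ('f, 'i, 'b) alg \<Rightarrow> ('b \<Rightarrow> 'a) topology)
      (T :: 'x topology \<Rightarrow> ('f, 'i, 'x \<Rightarrow> 'a) alg) \<phi>.
        natural_dual_adjunction P A Y S T \<phi>)"
proof
  have Y: "topspace Y = carr A" using assms(3) by (simp add: topological_algebra_def)
  show "schizophrenic TYPE('b) TYPE('x) P A Y"
    unfolding schizophrenic_def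
    using dual_space_hom_space[OF Y] dual_algebra_pointwise_algebra[OF assms(1,3)] by blast
  show "\<exists>(S :: ('f, 'i, 'b) alg \<Rightarrow> ('b \<Rightarrow> 'a) topology)
      (T :: 'x topology \<Rightarrow> ('f, 'i, 'x \<Rightarrow> 'a) alg) \<phi>. natural_dual_adjunction P A Y S T \<phi>"
    using natural_dual_adjunction_swap_args[OF assms(1,3)] by blast
qed

end
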